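(* For every connected graph $H$ (with at least three nodes, of constant size) and every $r \geq r_H$, where $r_H = \widetilde{\operatorname{diam}}(H) - 1$, the $r$-round bandwidth complexity of $\textsc{MemList}(H)$ under any single type of topological change (node insertions, node deletions, edge insertions, or edge deletions) is $O(n^2/r)$.
   Context: Node-edge distance: $\operatorname{dist}_G(u,\{v,w\}) = 1 + \min\{\operatorname{dist}_G(u,v), \operatorname{dist}_G(u,w)\}$; $\widetilde{\operatorname{diam}}(G) = \max_{u \in V(G)} \max_{e \in E(G)} \operatorname{dist}_G(u,e)$. Dynamic network model: a sequence of graphs $G^0, G^1, \ldots$ on $n$ nodes, each obtained from the previous by at most one topological change of the allowed type; nodes have distinct IDs from $[n]$, know their neighbors' IDs and initially the whole of $G^0$; communication is synchronous, each round the change happens first, then each node sends a $B$-bit message to each neighbor; nodes detect changes only via their neighbor lists; algorithms are deterministic. An $r$-round algorithm works under the promise that each change at round $i$ is followed by $r-1$ change-free rounds and must output correctly for $G^i$ by the end of round $i+r-1$. The $r$-round bandwidth complexity is the minimum such $B$. $\textsc{MemList}(H)$: each node $v$ lists all subgraphs isomorphic to $H$ containing $v$. *)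

theory Defs
  imports Complex_Main "HOL-Library.Extended_Nat"
begin

section \<open>Finite simple graphs\<close>

record 'a ugraph =
  verts :: "'a set"
  edges :: "'a set set"

definition simple_graph :: "'a ugraph \<Rightarrow> bool" where
  "simple_graph G \<longleftrightarrow>
     finite (verts G) \<and> (\<forall>e \<in> edges G. e \<subseteq> verts G \<and> card e = 2)"

definition adj :: "'a ugraph \<Rightarrow> ('a \<times> 'a) set" where
  "adj G = {(u, v). {u, v} \<in> edges G}"

definition nbrs :: "'a ugraph \<Rightarrow> 'a \<Rightarrow> 'a set" where
  "nbrs G v = {u. (v, u) \<in> adj G}"

definition connected_graph :: "'a ugraph \<Rightarrow> bool" where
  "connected_graph G \<longleftrightarrow>
     verts G \<noteq> {} \<and> (\<forall>u \<in> verts G. \<forall>v \<in> verts G. (u, v) \<in> (adj G)\<^sup>*)"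

text \<open>The distance is only meaningful for nodes joined by a path; it is used below for
  connected graphs only.\<close>

definition gdist :: "'a ugraph \<Rightarrow> 'a \<Rightarrow> 'a \<Rightarrow> nat" where
  "gdist G u v = (LEAST k. (u, v) \<in> adj G ^^ k)"

definition node_edge_dist :: "'a ugraph \<Rightarrow> 'a \<Rightarrow> 'a set \<Rightarrow> nat" where
  "node_edge_dist G u e = 1 + (MIN v \<in> e. gdist G u v)"

definition node_edge_diam :: "'a ugraph \<Rightarrow> nat" where
  "node_edge_diam G = (MAX u \<in> verts G. MAX e \<in> edges G. node_edge_dist G u e)"

definition subgraph_of :: "'a ugraph \<Rightarrow> 'a ugraph \<Rightarrow> bool" where
  "subgraph_of S G \<longleftrightarrow> simple_graph S \<and> verts S \<subseteq> verts G \<and> edges S \<subseteq> edges G"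

definition graph_iso :: "'a ugraph \<Rightarrow> 'b ugraph \<Rightarrow> bool" where
  "graph_iso G H \<longleftrightarrow>
     (\<exists>f. bij_betw f (verts G) (verts H) \<and> edges H = (\<lambda>e. f ` e) ` edges G)"


section \<open>Dynamic networks\<close>

datatype change_type = Node_Insertion | Node_Deletion | Edge_Insertion | Edge_Deletion

text \<open>An inserted node arrives together with an arbitrary set of edges to existing nodes.\<close>

fun change :: "change_type \<Rightarrow> 'a ugraph \<Rightarrow> 'a ugraph \<Rightarrow> bool" where
  "change Node_Insertion G G' \<longleftrightarrow>
     (\<exists>v N. v \<notin> verts G \<and> N \<subseteq> verts G \<and>
        G' = \<lparr>verts = insert v (verts G), edges = edges G \<union> {{v, u} | u. u \<in> N}\<rparr>)"
| "change Node_Deletion G G' \<longleftrightarrow>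
     (\<exists>v \<in> verts G. G' = \<lparr>verts = verts G - {v}, edges = {e \<in> edges G. v \<notin> e}\<rparr>)"
| "change Edge_Insertion G G' \<longleftrightarrow>
     (\<exists>u \<in> verts G. \<exists>v \<in> verts G. u \<noteq> v \<and> {u, v} \<notin> edges G \<and>
        G' = \<lparr>verts = verts G, edges = insert {u, v} (edges G)\<rparr>)"
| "change Edge_Deletion G G' \<longleftrightarrow>
     (\<exists>e \<in> edges G. G' = \<lparr>verts = verts G, edges = edges G - {e}\<rparr>)"

text \<open>Nodes are identified with their IDs, which come from \<open>{1..n}\<close>; so \<open>n\<close> bounds the number of
  nodes, which varies under node insertions and deletions. The last conjunct is the promise: a change in
  round \<open>i\<close> is followed by \<open>r - 1\<close> rounds without a change.\<close>

definition dynamic_network ::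
    "change_type \<Rightarrow> nat \<Rightarrow> nat \<Rightarrow> (nat \<Rightarrow> nat ugraph) \<Rightarrow> bool" where
  "dynamic_network c n r \<G> \<longleftrightarrow>
     (\<forall>i. simple_graph (\<G> i) \<and> verts (\<G> i) \<subseteq> {1..n}) \<and>
     (\<forall>i. \<G> (Suc i) = \<G> i \<or> change c (\<G> i) (\<G> (Suc i))) \<and>
     (\<forall>i \<ge> 1. \<G> i \<noteq> \<G> (i - 1) \<longrightarrow> (\<forall>j. i < j \<and> j < i + r \<longrightarrow> \<G> j = \<G> (j - 1)))"


section \<open>Deterministic distributed algorithms\<close>

text \<open>A history lists, for every round in which the node has been present, the set of its
  neighbours and the message received from each of them. Letting messages and outputs depend
  on the whole history loses no generality and avoids quantifying over a type of local states.\<close>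

type_synonym history = "(nat set \<times> (nat \<rightharpoonup> bool list)) list"

text \<open>The first three arguments are what a node knows at the start of a round: its ID, the
  initial graph (\<open>None\<close> if the node was inserted later) and its history. To compute the
  messages of a round it sees in addition its new set of neighbours; the last argument of
  \<open>message\<close> is the recipient.\<close>

record 'o algorithm =
  message :: "nat \<Rightarrow> nat ugraph option \<Rightarrow> history \<Rightarrow> nat set \<Rightarrow> nat \<Rightarrow> bool list"
  answer :: "nat \<Rightarrow> nat ugraph option \<Rightarrow> history \<Rightarrow> 'o"

definition initial_knowledge :: "(nat \<Rightarrow> nat ugraph) \<Rightarrow> nat \<Rightarrow> nat ugraph option" where
  "initial_knowledge \<G> v = (if v \<in> verts (\<G> 0) then Some (\<G> 0) else None)"

text \<open>\<open>hist A \<G> t v\<close> is the history of \<open>v\<close> at the end of round \<open>t\<close>. Round \<open>t \<ge> 1\<close> takes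
  place in \<open>\<G> t\<close>, that is, after the change of that round; there is no communication in
  round \<open>0\<close>.\<close>

primrec hist :: "'o algorithm \<Rightarrow> (nat \<Rightarrow> nat ugraph) \<Rightarrow> nat \<Rightarrow> nat \<Rightarrow> history" where
  "hist A \<G> 0 = (\<lambda>v. [])"
| "hist A \<G> (Suc t) = (\<lambda>v.
     if v \<in> verts (\<G> (Suc t)) then
       hist A \<G> t v @
         [(nbrs (\<G> (Suc t)) v,
           \<lambda>u. if u \<in> nbrs (\<G> (Suc t)) v
               then Some (message A u (initial_knowledge \<G> u) (hist A \<G> t u)
                            (nbrs (\<G> (Suc t)) u) v)
               else None)]
     else [])"

definition output_at ::
    "'o algorithm \<Rightarrow> (nat \<Rightarrow> nat ugraph) \<Rightarrow> nat \<Rightarrow> nat \<Rightarrow> 'o" where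
  "output_at A \<G> t v = answer A v (initial_knowledge \<G> v) (hist A \<G> t v)"

definition uses_bandwidth :: "'o algorithm \<Rightarrow> nat \<Rightarrow> bool" where
  "uses_bandwidth A B \<longleftrightarrow> (\<forall>v I h N u. length (message A v I h N u) = B)"

text \<open>A problem prescribes the output of every node of every graph. For a round \<open>i\<close> with a
  change, the premise that \<open>\<G>\<close> stays constant holds by the promise. The other
  rounds \<open>i\<close> (including \<open>0\<close>) require the output to be correct for the initial graph
  and to remain correct until the next change.\<close>

type_synonym 'o problem = "nat ugraph \<Rightarrow> nat \<Rightarrow> 'o"

definition solves ::
    "'o algorithm \<Rightarrow> 'o problem \<Rightarrow> change_type \<Rightarrow> nat \<Rightarrow> nat \<Rightarrow> bool" where
  "solves A P c n r \<longleftrightarrow>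
     (\<forall>\<G>. dynamic_network c n r \<G> \<longrightarrow>
        (\<forall>i. (\<forall>j. i \<le> j \<and> j < i + r \<longrightarrow> \<G> j = \<G> i) \<longrightarrow>
           (\<forall>v \<in> verts (\<G> i). output_at A \<G> (i + r - 1) v = P (\<G> i) v)))"

text \<open>The algorithm may depend on \<open>n\<close> and \<open>r\<close>. The value is \<open>\<infinity>\<close> if no bandwidth suffices.
  Bandwidth is an integer, and \<open>0\<close> bits carry no information however large \<open>r\<close> is, so a bound
  of order \<open>n\<^sup>2 / r\<close> has to be rounded up to an integer.\<close>

definition bandwidth_complexity ::
    "'o problem \<Rightarrow> change_type \<Rightarrow> nat \<Rightarrow> nat \<Rightarrow> enat" where
  "bandwidth_complexity P c n r =
     Inf {enat B | B. \<exists>A. uses_bandwidth A B \<and> solves A P c n r}"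

definition MemList :: "'a ugraph \<Rightarrow> nat ugraph set problem" where
  "MemList H G v = {S. subgraph_of S G \<and> graph_iso S H \<and> v \<in> verts S}"

end

theory Submission
  imports Defs
begin

text \<open>
  Under a single type of change the edge set of the network is monotone: once observed, the presence of
  an edge (insertions) or its absence (deletions) remains true forever. So facts can be gossiped
  without time stamps. With \<open>R = node_edge_diam H - 1\<close> and \<open>T = r div R\<close>, every node keeps
  a bitmap of at most \<open>n\<^sup>2\<close> facts about node pairs and sends it cyclically in \<open>T\<close> pieces. Any fact
  thus crosses an edge within \<open>T\<close> rounds and travels distance \<open>R\<close> within \<open>r\<close> rounds, which is
  as far as a copy of \<open>H\<close> can reach. Inserted nodes do not know the round number, but both ends
  of an edge know for how long it has been present, and this determines the piece to send.
\<close>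

section \<open>Graphs\<close>

lemma adj_iff: "(u, v) \<in> adj G \<longleftrightarrow> {u, v} \<in> edges G"
  by (simp add: adj_def)

lemma nbrs_iff: "u \<in> nbrs G v \<longleftrightarrow> {v, u} \<in> edges G"
  by (simp add: nbrs_def adj_iff)

lemma simple_graph_edge_verts:
  assumes "simple_graph G" "{u, v} \<in> edges G"
  shows "u \<in> verts G" "v \<in> verts G"
  using assms by (auto simp: simple_graph_def)

lemma simple_graph_edgeE:
  assumes "simple_graph G" "e \<in> edges G"
  obtains a b where "e = {a, b}" "a \<noteq> b"
  using assms unfolding simple_graph_def by (meson card_2_iff)

lemma relpow_adj_sym: "(u, v) \<in> adj G ^^ k \<Longrightarrow> (v, u) \<in> adj G ^^ k"
proof (induction k arbitrary: v)
  case (Suc k)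
  then obtain w where "(u, w) \<in> adj G ^^ k" "(w, v) \<in> adj G"
    by auto
  with Suc.IH show ?case
    by (intro relpow_Suc_I2[of v w]) (auto simp: adj_iff insert_commute)
qed simp

lemma relpow_adj_mono:
  assumes "edges S \<subseteq> edges G"
  shows "(u, v) \<in> adj S ^^ k \<Longrightarrow> (u, v) \<in> adj G ^^ k"
  using assms by (induction k arbitrary: v) (auto simp: adj_def)

lemma relpow_adj_verts:
  assumes "simple_graph G" "u \<in> verts G" "(u, v) \<in> adj G ^^ k"
  shows "v \<in> verts G"
  using assms by (cases k) (auto simp: adj_iff dest: simple_graph_edge_verts)

lemma finite_edges: "simple_graph G \<Longrightarrow> finite (edges G)"
  unfolding simple_graph_def by (meson PowI finite_Pow_iff finite_subset subsetI)

section \<open>Distances and the node-edge diameter of a connected graph\<close>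

lemma connected_graph_incident_edge:
  assumes "connected_graph H" "card (verts H) \<ge> 2" "v \<in> verts H"
  obtains w where "{v, w} \<in> edges H"
proof -
  have "\<not> verts H \<subseteq> {v}"
    using assms(2) card_mono[of "{v}" "verts H"] by auto
  then obtain w where "w \<in> verts H" "w \<noteq> v"
    by blast
  then have "(v, w) \<in> (adj H)\<^sup>*" "v \<noteq> w"
    using assms by (auto simp: connected_graph_def)
  then obtain x where "(v, x) \<in> adj H"
    by (meson converse_rtranclE)
  then show thesis
    using that by (simp add: adj_iff)
qed

lemma relpow_gdist:
  assumes "connected_graph H" "u \<in> verts H" "v \<in> verts H"
  shows "(u, v) \<in> adj H ^^ gdist H u v"
proof -
  have "\<exists>k. (u, v) \<in> adj H ^^ k"
    using assms by (auto simp: connected_graph_def rtrancl_power)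
  then show ?thesis
    unfolding gdist_def by (rule LeastI_ex)
qed

lemma node_edge_dist_le_diam:
  assumes "simple_graph H" "u \<in> verts H" "e \<in> edges H"
  shows "node_edge_dist H u e \<le> node_edge_diam H"
proof -
  have "node_edge_dist H u e \<le> (MAX e \<in> edges H. node_edge_dist H u e)"
    using assms finite_edges by (intro Max_ge) auto
  also have "\<dots> \<le> node_edge_diam H"
    unfolding node_edge_diam_def using assms by (intro Max_ge) (auto simp: simple_graph_def)
  finally show ?thesis .
qed

text \<open>The subtracted \<open>1\<close> undoes the \<open>1 +\<close> in
  \<open>node_edge_dist\<close>: what remains is the number of hops from \<open>u\<close> to the
  nearer end of \<open>e\<close>, the distance that news about \<open>e\<close> must travel to reach
  \<open>u\<close>.\<close>

lemma edge_end_within_diam: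
  assumes "simple_graph H" "connected_graph H" "u \<in> verts H" "e \<in> edges H"
  obtains a k where "a \<in> e" "k \<le> node_edge_diam H - 1" "(u, a) \<in> adj H ^^ k"
proof -
  have fin: "finite e" "e \<noteq> {}" "e \<subseteq> verts H"
    using assms unfolding simple_graph_def by (auto intro: finite_subset)
  then have "(MIN v \<in> e. gdist H u v) \<in> gdist H u ` e"
    by (intro Min_in) auto
  then obtain a where a: "a \<in> e" "(MIN v \<in> e. gdist H u v) = gdist H u a"
    by auto
  have "gdist H u a \<le> node_edge_diam H - 1"
    using node_edge_dist_le_diam[OF assms(1,3,4)] a by (simp add: node_edge_dist_def)
  moreover have "(u, a) \<in> adj H ^^ gdist H u a"
    using a fin assms by (intro relpow_gdist) auto
  ultimately show thesis
    using a by (intro that)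
qed

text \<open>A third node lies off any given edge and so has at least one hop to go. This makes the
  hop count \<open>node_edge_diam H - 1\<close> positive, so that rounds can be divided by
  it.\<close>

lemma node_edge_diam_ge_2:
  assumes "simple_graph H" "connected_graph H" "card (verts H) \<ge> 3"
  shows "node_edge_diam H \<ge> 2"
proof -
  obtain v where v: "v \<in> verts H"
    using assms(2) by (auto simp: connected_graph_def)
  obtain w where e: "{v, w} \<in> edges H"
    using assms v by (auto intro: connected_graph_incident_edge[of H v])
  have "card {v, w} < card (verts H)"
    using assms(3) card_insert_le_m1[of 2 "{w}" v] by auto
  then have "\<not> verts H \<subseteq> {v, w}"
    using card_mono[of "{v, w}" "verts H"] by auto
  then obtain u where u: "u \<in> verts H" "u \<noteq> v" "u \<noteq> w"
    by blast
  have "gdist H u a > 0" if "a \<in> {v, w}" for a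
  proof (rule ccontr)
    assume "\<not> gdist H u a > 0"
    moreover have "(u, a) \<in> adj H ^^ gdist H u a"
      using that u simple_graph_edge_verts[OF assms(1) e] assms by (intro relpow_gdist) auto
    ultimately show False
      using u that by auto
  qed
  then have "node_edge_dist H u {v, w} \<ge> 2"
    unfolding node_edge_dist_def by (simp add: Suc_le_eq)
  also have "node_edge_dist H u {v, w} \<le> node_edge_diam H"
    using assms u e by (intro node_edge_dist_le_diam)
  finally show ?thesis .
qed

section \<open>Isomorphic copies of \<open>H\<close>\<close>

lemma iso_edge_reflect:
  assumes "simple_graph S" "bij_betw f (verts S) (verts H)" "edges H = (\<lambda>e. f ` e) ` edges S"
    and "x \<in> verts S" "y \<in> verts S" "{f x, f y} \<in> edges H"
  shows "{x, y} \<in> edges S"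
proof -
  obtain e where e: "e \<in> edges S" "f ` e = f ` {x, y}"
    using assms(3,6) by auto
  moreover have "e \<subseteq> verts S" "{x, y} \<subseteq> verts S"
    using e assms by (auto simp: simple_graph_def)
  ultimately have "e = {x, y}"
    using assms(2) by (meson bij_betw_imp_inj_on inj_on_image_eq_iff)
  with e show ?thesis
    by simp
qed

lemma iso_relpow_reflect:
  assumes "simple_graph S" "simple_graph H"
    and f: "bij_betw f (verts S) (verts H)" "edges H = (\<lambda>e. f ` e) ` edges S"
    and "x \<in> verts S"
  shows "y \<in> verts S \<Longrightarrow> (f x, f y) \<in> adj H ^^ k \<Longrightarrow> (x, y) \<in> adj S ^^ k"
proof (induction k arbitrary: y)
  case 0
  then show ?case
    using assms bij_betw_imp_inj_on[OF f(1)] by (auto dest: inj_onD)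
next
  case (Suc k)
  then obtain w where w: "(f x, w) \<in> adj H ^^ k" "{w, f y} \<in> edges H"
    by (auto simp: adj_iff)
  then have "w \<in> verts H"
    using simple_graph_edge_verts(1)[OF assms(2)] by simp
  then obtain z where "z \<in> verts S" "w = f z"
    using f(1) by (metis bij_betw_imp_surj_on imageE)
  with Suc w have "(x, z) \<in> adj S ^^ k" "{z, y} \<in> edges S"
    using iso_edge_reflect[OF assms(1) f, of z y] by auto
  then show ?case
    by (auto simp: adj_iff)
qed

text \<open>The bound for \<open>H\<close> is pulled back along the isomorphism. The resulting path
  uses edges of the copy \<open>S\<close> only, so it is also a path in every graph that contains
  those edges.\<close>

lemma copy_edge_end_within_diam:
  assumes "simple_graph S" "simple_graph H" "connected_graph H" "graph_iso S H"
    and "v \<in> verts S" "e \<in> edges S"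
  obtains a k where "a \<in> e" "k \<le> node_edge_diam H - 1" "(v, a) \<in> adj S ^^ k"
proof -
  obtain f where f: "bij_betw f (verts S) (verts H)" "edges H = (\<lambda>e. f ` e) ` edges S"
    using assms by (auto simp: graph_iso_def)
  have "f v \<in> verts H" "f ` e \<in> edges H"
    using f assms by (auto simp: bij_betw_def)
  then obtain a' k where a': "a' \<in> f ` e" "k \<le> node_edge_diam H - 1" "(f v, a') \<in> adj H ^^ k"
    using assms by (meson edge_end_within_diam)
  then obtain a where "a \<in> e" "a' = f a"
    by blast
  moreover have "e \<subseteq> verts S"
    using assms by (auto simp: simple_graph_def)
  ultimately show thesis
    using a' iso_relpow_reflect[OF assms(1,2) f assms(5), of a k] that[of a k] by auto
qed

text \<open>Every node of a copy lies on one of its edges, by connectedness and size of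
  \<open>H\<close>, so containment of the edges already forces containment of the nodes.\<close>

lemma copy_subgraph_iff:
  assumes "simple_graph S" "connected_graph H" "card (verts H) \<ge> 2" "graph_iso S H"
    and "simple_graph G"
  shows "subgraph_of S G \<longleftrightarrow> edges S \<subseteq> edges G"
proof
  assume sub: "edges S \<subseteq> edges G"
  obtain f where f: "bij_betw f (verts S) (verts H)" "edges H = (\<lambda>e. f ` e) ` edges S"
    using assms by (auto simp: graph_iso_def)
  have "x \<in> verts G" if x: "x \<in> verts S" for x
  proof -
    have "f x \<in> verts H"
      using f x by (auto simp: bij_betw_def)
    then obtain w where "{f x, w} \<in> edges H"
      using assms connected_graph_incident_edge by metis
    then obtain e where e: "e \<in> edges S" "f ` e = {f x, w}"
      using f by auto
    then obtain y where y: "y \<in> e" "f y = f x"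
      by (metis imageE insertI1)
    have eS: "e \<subseteq> verts S"
      using e assms by (auto simp: simple_graph_def)
    then have "x = y"
      using x y f by (metis bij_betw_imp_inj_on inj_onD subsetD)
    with y e sub assms(5) show ?thesis
      by (auto simp: simple_graph_def)
  qed
  with sub assms show "subgraph_of S G"
    by (auto simp: subgraph_of_def)
qed (simp add: subgraph_of_def)


section \<open>Gossiping\<close>

text \<open>Here histories are reversed, so that the most recent round comes first.\<close>

definition edge_age :: "nat \<Rightarrow> history \<Rightarrow> nat" where
  "edge_age u h = length (takeWhile (\<lambda>x. u \<in> fst x) h)"

text \<open>A round with the edge adds one to both counts. A round without it sets both to zero,
  whether an end is present without the edge or is absent and has an empty history.\<close>

lemma edge_age_sym:
  assumes "\<And>t. simple_graph (\<G> t)"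
  shows "edge_age u (rev (hist A \<G> t v)) = edge_age v (rev (hist A \<G> t u))"
  using simple_graph_edge_verts[OF assms]
  by (induction t) (auto simp: edge_age_def nbrs_iff insert_commute)

lemma edge_age_add:
  assumes "\<And>t. simple_graph (\<G> t)"
    and "\<And>s. t < s \<Longrightarrow> s \<le> t + k \<Longrightarrow> {u, v} \<in> edges (\<G> s)"
  shows "edge_age u (rev (hist A \<G> (t + k) v)) = edge_age u (rev (hist A \<G> t v)) + k"
  using assms(2)
proof (induction k)
  case (Suc k)
  have "{u, v} \<in> edges (\<G> (Suc (t + k)))"
    using Suc.prems by simp
  moreover from this have "v \<in> verts (\<G> (Suc (t + k)))"
    using simple_graph_edge_verts(2)[OF assms(1)] by blast
  ultimately show ?case
    using Suc by (simp add: edge_age_def nbrs_iff insert_commute)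
qed simp

text \<open>\<open>T\<close> is the number of pieces and \<open>B\<close> their size in bits.
  \<open>own\<close> gives the facts that a node reads off its neighbor set; \<open>report\<close>
  turns its ID, initial knowledge and collected facts into an output.\<close>

locale gossip =
  fixes facts :: "'f list" and T B :: nat
    and own :: "nat \<Rightarrow> nat set \<Rightarrow> 'f set"
    and report :: "nat \<Rightarrow> nat ugraph option \<Rightarrow> 'f set \<Rightarrow> 'o"
begin

text \<open>Piece number \<open>c mod T\<close> of the bitmap of \<open>K\<close>. Positions past
  the end of \<open>facts\<close> are padded with \<open>False\<close>, so every message has exactly
  \<open>B\<close> bits.\<close>

definition encode :: "nat \<Rightarrow> 'f set \<Rightarrow> bool list" where
  "encode c K = map (\<lambda>p. c mod T * B + p < length facts \<and> facts ! (c mod T * B + p) \<in> K) [0..<B]"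

definition decode :: "nat \<Rightarrow> bool list \<Rightarrow> 'f set" where
  "decode c bs = {facts ! (c mod T * B + p) | p. p < length bs \<and> bs ! p}"

definition piece :: "nat \<Rightarrow> 'f set" where
  "piece c = {facts ! (c mod T * B + p) | p. p < B \<and> c mod T * B + p < length facts}"

lemma decode_encode: "decode c (encode c K) = K \<inter> piece c"
  by (auto simp: decode_def encode_def piece_def)

text \<open>The piece numbers run cyclically, so \<open>T\<close> consecutive clock values starting
  anywhere meet every piece.\<close>

lemma in_some_piece:
  assumes "T > 0" "length facts \<le> T * B" "e \<in> set facts"
  obtains k where "k < T" "e \<in> piece (c + k)"
proof -
  obtain j where j: "j < length facts" "facts ! j = e"
    using assms(3) by (auto simp: in_set_conv_nth)
  define q where "q = j div B"
  have B: "B > 0"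
    using j assms by (cases "B = 0") auto
  have q: "q < T"
    unfolding q_def using j assms by (simp add: less_mult_imp_div_less)
  \<comment> \<open>This is the cyclic distance from \<open>c mod T\<close> to the wanted piece
    \<open>q\<close>; \<open>T\<close> is added first so that the subtraction on naturals does not
    truncate.\<close>
  define k where "k = (q + (T - c mod T)) mod T"
  have "(c + k) mod T = (c mod T + (q + (T - c mod T))) mod T"
    unfolding k_def by (metis mod_add_left_eq mod_add_right_eq)
  also have "c mod T + (q + (T - c mod T)) = q + T"
    using mod_less_divisor[OF assms(1), of c] by linarith
  finally have "(c + k) mod T = q"
    using q by simp
  moreover have "j = q * B + j mod B"
    by (simp add: q_def)
  ultimately have "e \<in> piece (c + k)"
    unfolding piece_def using j B by (metis (mono_tags, lifting) mem_Collect_eq mod_less_divisor)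
  moreover have "k < T"
    using assms(1) by (simp add: k_def)
  ultimately show thesis
    using that by blast
qed

text \<open>The clock is read off the history \<open>h\<close> before the current round, as the
  sender did when it chose the piece.\<close>

primrec known :: "nat \<Rightarrow> history \<Rightarrow> 'f set" where
  "known v [] = {}"
| "known v (x # h) =
     known v h \<union> own v (fst x) \<union> (\<Union>u \<in> fst x. decode (edge_age u h) (the (snd x u)))"

text \<open>A message already includes what the sender observes in the current round, so no round is
  lost between noticing a change and forwarding it.\<close>

definition alg :: "'o algorithm" where
  "alg = \<lparr>message = \<lambda>v I h N u. encode (edge_age u (rev h)) (known v (rev h) \<union> own v N),
          answer = \<lambda>v I h. report v I (known v (rev h))\<rparr>"

lemma uses_bandwidth_alg: "uses_bandwidth alg B"
  by (simp add: uses_bandwidth_def alg_def encode_def)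

end

section \<open>Spread of facts during a run\<close>

locale gossip_run = gossip facts T B own report
  for facts :: "'f list" and T B :: nat
    and own :: "nat \<Rightarrow> nat set \<Rightarrow> 'f set"
    and report :: "nat \<Rightarrow> nat ugraph option \<Rightarrow> 'f set \<Rightarrow> 'o" +
  fixes \<G> :: "nat \<Rightarrow> nat ugraph"
  assumes simple: "simple_graph (\<G> t)"
    and T_pos: "T > 0"
    and facts_fit: "length facts \<le> T * B"
begin

abbreviation knows :: "nat \<Rightarrow> nat \<Rightarrow> 'f set" where
  "knows t v \<equiv> known v (rev (hist alg \<G> t v))"

definition sees :: "nat \<Rightarrow> nat \<Rightarrow> 'f set" where
  "sees t v = own v (nbrs (\<G> t) v)"

lemma output_at_alg: "output_at alg \<G> t v = report v (initial_knowledge \<G> v) (knows t v)"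
  by (simp add: output_at_def alg_def)

lemma knows_Suc:
  assumes "v \<in> verts (\<G> (Suc t))"
  shows "knows (Suc t) v = knows t v \<union> sees (Suc t) v \<union>
    (\<Union>u \<in> nbrs (\<G> (Suc t)) v.
       (knows t u \<union> sees (Suc t) u) \<inter> piece (edge_age u (rev (hist alg \<G> t v))))"
proof -
  have "decode (edge_age u (rev (hist alg \<G> t v)))
      (message alg u I (hist alg \<G> t u) (nbrs (\<G> (Suc t)) u) v) =
    (knows t u \<union> sees (Suc t) u) \<inter> piece (edge_age u (rev (hist alg \<G> t v)))" for u I
  proof -
    have "edge_age u (rev (hist alg \<G> t v)) = edge_age v (rev (hist alg \<G> t u))"
      by (rule edge_age_sym[OF simple])
    then show ?thesis
      by (simp add: alg_def decode_encode sees_def)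
  qed
  with assms show ?thesis
    by (auto simp: sees_def)
qed

declare hist.simps(2) [simp del]

text \<open>Presence matters because a node absent from the network has its history erased.\<close>

lemma knows_mono:
  assumes "t \<le> t'" "\<And>s. t < s \<Longrightarrow> s \<le> t' \<Longrightarrow> v \<in> verts (\<G> s)"
  shows "knows t v \<subseteq> knows t' v"
  using assms
proof (induction t' rule: dec_induct)
  case (step m)
  then have "v \<in> verts (\<G> (Suc m))"
    by simp
  with step show ?case
    by (auto simp: knows_Suc)
qed simp

text \<open>Every collected fact was observed by some node in some earlier or current round, and
  \<open>F\<close> never loses facts. For insertions \<open>F\<close> will be the edge set, for
  deletions its complement.\<close>

lemma knows_sound:
  assumes "\<And>t. F t \<subseteq> F (Suc t)" "\<And>t v. sees t v \<subseteq> F t"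
  shows "knows t v \<subseteq> F t"
proof (induction t arbitrary: v)
  case (Suc t)
  show ?case
  proof (cases "v \<in> verts (\<G> (Suc t))")
    case True
    with Suc assms show ?thesis
      unfolding knows_Suc[OF True] by blast
  qed (simp add: hist.simps(2))
qed simp

lemma knows_hop:
  assumes edge: "\<And>s. t < s \<Longrightarrow> s \<le> t + T \<Longrightarrow> {x, y} \<in> edges (\<G> s)"
    and e: "e \<in> knows t x \<union> sees (Suc t) x" "e \<in> set facts"
  shows "e \<in> knows (t + T) y"
proof -
  have pres: "x \<in> verts (\<G> s)" "y \<in> verts (\<G> s)" if "t < s" "s \<le> t + T" for s
    using simple_graph_edge_verts[OF simple edge] that by auto
  \<comment> \<open>The clock of the edge may start at any value; \<open>k\<close> is the delay
    until the piece containing \<open>e\<close> is due.\<close>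
  obtain k where k: "k < T" "e \<in> piece (edge_age x (rev (hist alg \<G> t y)) + k)"
    using in_some_piece[OF T_pos facts_fit e(2)] .
  \<comment> \<open>For \<open>k = 0\<close> the fact may be only just observed, in round
    \<open>t + 1\<close>; for larger \<open>k\<close> it has entered the memory of \<open>x\<close>
    by the end of that round.\<close>
  have "e \<in> knows (t + k) x \<union> sees (Suc (t + k)) x"
  proof (cases k)
    case (Suc l)
    have "e \<in> knows (Suc t) x"
      using e pres[of "Suc t"] T_pos by (auto simp: knows_Suc)
    also have "\<dots> \<subseteq> knows (t + k) x"
      using Suc k pres by (intro knows_mono) auto
    finally show ?thesis ..
  qed (use e in simp)
  moreover have "edge_age x (rev (hist alg \<G> (t + k) y)) = edge_age x (rev (hist alg \<G> t y)) + k"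
    using k edge by (intro edge_age_add simple) auto
  moreover have "x \<in> nbrs (\<G> (Suc (t + k))) y"
    using edge[of "Suc (t + k)"] k by (simp add: nbrs_iff insert_commute)
  ultimately have "e \<in> knows (Suc (t + k)) y"
    using k pres[of "Suc (t + k)"] by (auto simp: knows_Suc)
  also have "\<dots> \<subseteq> knows (t + T) y"
    using k pres by (intro knows_mono) auto
  finally show ?thesis .
qed

lemma knows_path:
  assumes const: "\<And>s. t < s \<Longrightarrow> s \<le> t + r \<Longrightarrow> \<G> s = G"
    and r: "0 < r"
    and a: "a \<in> verts G" "e \<in> own a (nbrs G a)" "e \<in> set facts"
    and path: "(a, v) \<in> adj G ^^ k" "k * T \<le> r"
  shows "e \<in> knows (t + r) v"
proof -
  have G: "simple_graph G"
    using simple[of "Suc t"] const[of "Suc t"] r by simp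
  \<comment> \<open>At the end of round \<open>t\<close> the origin \<open>a\<close> need not know
    \<open>e\<close> yet: it observes \<open>e\<close> in round \<open>t + 1\<close> and starts
    sending in that same round. The second disjunct covers this start, so that \<open>k\<close> hops
    take \<open>k * T\<close> rounds and not one more.\<close>
  have "e \<in> knows (t + k * T) v \<or> k = 0 \<and> v = a"
    using path
  proof (induction k arbitrary: v)
    case (Suc k)
    then obtain w where w: "(a, w) \<in> adj G ^^ k" "{w, v} \<in> edges G"
      by (auto simp: adj_iff)
    have "Suc (t + k * T) \<le> t + r"
      using Suc.prems T_pos by auto
    then have "\<G> (Suc (t + k * T)) = G"
      by (intro const) auto
    with Suc w a have "e \<in> knows (t + k * T) w \<union> sees (Suc (t + k * T)) w"
      by (auto simp: sees_def)
    moreover have "{w, v} \<in> edges (\<G> s)" if "t + k * T < s" "s \<le> t + k * T + T" for s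
      using const[of s] that Suc.prems w by auto
    ultimately have "e \<in> knows (t + k * T + T) v"
      using a by (intro knows_hop) auto
    then show ?case
      by (simp add: add_ac)
  qed simp
  then show ?thesis
  proof
    assume "e \<in> knows (t + k * T) v"
    also have "\<dots> \<subseteq> knows (t + r) v"
      using path const relpow_adj_verts[OF G a(1)] by (intro knows_mono) auto
    finally show ?thesis .
  next
    assume *: "k = 0 \<and> v = a"
    have "e \<in> knows (Suc t) a"
      using a const[of "Suc t"] r by (auto simp: knows_Suc sees_def)
    also have "\<dots> \<subseteq> knows (t + r) a"
      using const a r by (intro knows_mono) auto
    finally show ?thesis
      using * by simp
  qed
qed

end


section \<open>Listing copies of \<open>H\<close>\<close>

text \<open>Ordered pairs, so each edge occurs twice and singletons occur too; this redundancy costs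
  only a constant factor and makes the length exactly \<open>n\<^sup>2\<close>.\<close>

definition pair_facts :: "nat \<Rightarrow> nat set list" where
  "pair_facts n = map (\<lambda>(a, b). {a, b}) (List.product [1..<Suc n] [1..<Suc n])"

lemma length_pair_facts: "length (pair_facts n) = n\<^sup>2"
  by (simp add: pair_facts_def power2_eq_square)

lemma edge_in_pair_facts:
  assumes "simple_graph G" "verts G \<subseteq> {1..n}" "e \<in> edges G"
  shows "e \<in> set (pair_facts n)"
proof -
  obtain a b where e: "e = {a, b}"
    using assms simple_graph_edgeE by metis
  with simple_graph_edge_verts[of G a b] assms have "a \<in> {1..n}" "b \<in> {1..n}"
    by auto
  then show ?thesis
    unfolding pair_facts_def e by (force simp: image_iff)
qed

definition known_present :: "nat \<Rightarrow> nat set \<Rightarrow> nat set set" where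
  "known_present v N = {{v, b} | b. b \<in> N}"

text \<open>An infinite set, since \<open>b\<close> is unrestricted; messages can carry only its
  members from the list of facts.\<close>

definition known_absent :: "nat \<Rightarrow> nat set \<Rightarrow> nat set set" where
  "known_absent v N = {{v, b} | b. b \<notin> N}"

text \<open>The vertex set is irrelevant for a connected \<open>H\<close>, so a set of edges is enough for an answer.\<close>

definition copies_in :: "'a ugraph \<Rightarrow> nat set set \<Rightarrow> nat \<Rightarrow> nat ugraph set" where
  "copies_in H E v = {S. simple_graph S \<and> edges S \<subseteq> E \<and> graph_iso S H \<and> v \<in> verts S}"

lemma copies_in_cong:
  assumes "E \<subseteq> E'"
    and "\<And>S. \<lbrakk>simple_graph S; edges S \<subseteq> E'; graph_iso S H; v \<in> verts S\<rbrakk> \<Longrightarrow> edges S \<subseteq> E"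
  shows "copies_in H E v = copies_in H E' v"
  using assms unfolding copies_in_def by (intro Collect_cong) (metis subset_trans)

lemma MemList_eq_copies_in:
  assumes "connected_graph H" "card (verts H) \<ge> 2" "simple_graph G"
  shows "MemList H G v = copies_in H (edges G) v"
  unfolding MemList_def copies_in_def
  using copy_subgraph_iff[OF _ assms(1,2) _ assms(3)] by (auto simp: subgraph_of_def)

text \<open>A node inserted later has no initial graph and starts from the empty edge set.\<close>

definition report_present ::
    "'a ugraph \<Rightarrow> nat \<Rightarrow> nat ugraph option \<Rightarrow> nat set set \<Rightarrow> nat ugraph set" where
  "report_present H v I K = copies_in H ((case I of Some G \<Rightarrow> edges G | None \<Rightarrow> {}) \<union> K) v"

definition report_absent ::
    "'a ugraph \<Rightarrow> nat \<Rightarrow> nat ugraph option \<Rightarrow> nat set set \<Rightarrow> nat ugraph set" where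
  "report_absent H v I K = copies_in H (edges (the I) - K) v"

section \<open>Correctness under insertions and under deletions\<close>

lemma insertion_edges_mono:
  assumes "dynamic_network c n r \<G>" "c = Node_Insertion \<or> c = Edge_Insertion"
  shows "edges (\<G> t) \<subseteq> edges (\<G> (Suc t))"
proof -
  have "\<G> (Suc t) = \<G> t \<or> change c (\<G> t) (\<G> (Suc t))"
    using assms by (simp add: dynamic_network_def)
  with assms(2) show ?thesis
    by auto
qed

lemma deletion_antimono:
  assumes "dynamic_network c n r \<G>" "c = Node_Deletion \<or> c = Edge_Deletion"
  shows "edges (\<G> (Suc t)) \<subseteq> edges (\<G> t)" "verts (\<G> (Suc t)) \<subseteq> verts (\<G> t)"
proof -
  have "\<G> (Suc t) = \<G> t \<or> change c (\<G> t) (\<G> (Suc t))"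
    using assms by (simp add: dynamic_network_def)
  with assms(2) show "edges (\<G> (Suc t)) \<subseteq> edges (\<G> t)" "verts (\<G> (Suc t)) \<subseteq> verts (\<G> t)"
    by auto
qed

text \<open>Collected edges are real and persist, so nothing false is listed. Each edge of a genuine
  copy has an end near \<open>v\<close> along the copy, hence along the current network, and that
  end reports it in time.\<close>

lemma insertion_solves:
  fixes H :: "'a ugraph"
  assumes H: "simple_graph H" "connected_graph H" "card (verts H) \<ge> 2"
    and c: "c = Node_Insertion \<or> c = Edge_Insertion"
    and T: "T > 0" "n\<^sup>2 \<le> T * B" "(node_edge_diam H - 1) * T \<le> r" and r: "r > 0"
  shows "solves (gossip.alg (pair_facts n) T B known_present (report_present H)) (MemList H) c n r"
  unfolding solves_def
proof (intro allI impI ballI)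
  fix \<G> i v
  assume dyn: "dynamic_network c n r \<G>"
    and const: "\<forall>j. i \<le> j \<and> j < i + r \<longrightarrow> \<G> j = \<G> i" and v: "v \<in> verts (\<G> i)"
  have graphs: "simple_graph (\<G> t)" "verts (\<G> t) \<subseteq> {1..n}" for t
    using dyn by (auto simp: dynamic_network_def)
  interpret gossip_run "pair_facts n" T B known_present "report_present H" \<G>
    by unfold_locales (use graphs T in \<open>auto simp: length_pair_facts\<close>)
  let ?I = "case initial_knowledge \<G> v of Some G \<Rightarrow> edges G | None \<Rightarrow> {}"
  let ?K = "knows (i + r - 1) v"
  have mono: "edges (\<G> t) \<subseteq> edges (\<G> (Suc t))" for t
    using insertion_edges_mono[OF dyn c] .
  have "\<G> (i + r - 1) = \<G> i"
    using const[rule_format, of "i + r - 1"] r by simp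
  moreover have "?K \<subseteq> edges (\<G> (i + r - 1))"
    by (rule knows_sound) (use mono in \<open>auto simp: sees_def known_present_def nbrs_iff\<close>)
  moreover have "?I \<subseteq> edges (\<G> i)"
    using lift_Suc_mono_le[of "\<lambda>t. edges (\<G> t)" 0 i] mono
    by (auto simp: initial_knowledge_def)
  ultimately have sound: "?I \<union> ?K \<subseteq> edges (\<G> i)"
    by simp
  have complete: "e \<in> ?I \<union> ?K"
    if S: "simple_graph S" "edges S \<subseteq> edges (\<G> i)" "graph_iso S H" "v \<in> verts S"
      and e: "e \<in> edges S" for S e
  proof (cases i)
    \<comment> \<open>For \<open>i = 0\<close> only \<open>r - 1\<close> rounds of communication
      have taken place, but \<open>v\<close> has known \<open>\<G> 0\<close> from the start.\<close>
    case 0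
    with e v S show ?thesis
      by (auto simp: initial_knowledge_def)
  next
    case (Suc t)
    obtain a k where a: "a \<in> e" "k \<le> node_edge_diam H - 1" "(v, a) \<in> adj S ^^ k"
      using copy_edge_end_within_diam[OF S(1) H(1,2) S(3,4) e] .
    have path: "(v, a) \<in> adj (\<G> i) ^^ k"
      using relpow_adj_mono[OF S(2) a(3)] .
    obtain b where b: "e = {a, b}"
      using simple_graph_edgeE[OF S(1) e] a by (metis doubleton_eq_iff insertE singletonD)
    have eG: "e \<in> edges (\<G> i)"
      using S e by auto
    \<comment> \<open>With \<open>i = Suc t\<close>, rounds \<open>i\<close> to
      \<open>i + r - 1\<close> are exactly the \<open>r\<close> rounds after \<open>t\<close>,
      including the round of the change itself.\<close>
    have window: "\<G> s = \<G> i" if "t < s" "s \<le> t + r" for s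
      using const[rule_format, of s] that Suc by simp
    have "k * T \<le> r"
      using a T by (meson le_trans mult_le_mono1)
    then have "e \<in> knows (t + r) v"
      using b eG relpow_adj_sym[OF path] relpow_adj_verts[OF graphs(1) v path]
        edge_in_pair_facts[OF graphs eG]
      by (intro knows_path[OF window r, where a = a and k = k])
        (auto simp: known_present_def nbrs_iff)
    with Suc show ?thesis
      by simp
  qed
  have "copies_in H (?I \<union> ?K) v = copies_in H (edges (\<G> i)) v"
    using sound by (rule copies_in_cong) (use complete in blast)
  then show "output_at alg \<G> (i + r - 1) v = MemList H (\<G> i) v"
    using H graphs by (simp add: output_at_alg report_present_def MemList_eq_copies_in)
qed

text \<open>Known absences are genuine and permanent, so no current edge is discarded. The
  difficulty is to rule out stale copies: paths of such a copy might be broken and unable to carry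
  the news.\<close>

lemma deletion_solves:
  fixes H :: "'a ugraph"
  assumes H: "simple_graph H" "connected_graph H" "card (verts H) \<ge> 2"
    and c: "c = Node_Deletion \<or> c = Edge_Deletion"
    and T: "T > 0" "n\<^sup>2 \<le> T * B" "(node_edge_diam H - 1) * T \<le> r" and r: "r > 0"
  shows "solves (gossip.alg (pair_facts n) T B known_absent (report_absent H)) (MemList H) c n r"
  unfolding solves_def
proof (intro allI impI ballI)
  fix \<G> i v
  assume dyn: "dynamic_network c n r \<G>"
    and const: "\<forall>j. i \<le> j \<and> j < i + r \<longrightarrow> \<G> j = \<G> i" and v: "v \<in> verts (\<G> i)"
  have graphs: "simple_graph (\<G> t)" "verts (\<G> t) \<subseteq> {1..n}" for t
    using dyn by (auto simp: dynamic_network_def)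
  interpret gossip_run "pair_facts n" T B known_absent "report_absent H" \<G>
    by unfold_locales (use graphs T in \<open>auto simp: length_pair_facts\<close>)
  let ?K = "knows (i + r - 1) v"
  have anti: "edges (\<G> (Suc t)) \<subseteq> edges (\<G> t)" "verts (\<G> (Suc t)) \<subseteq> verts (\<G> t)" for t
    using deletion_antimono[OF dyn c] by auto
  have init: "edges (\<G> i) \<subseteq> edges (\<G> 0)" "verts (\<G> i) \<subseteq> verts (\<G> 0)"
    using lift_Suc_antimono_le[of "\<lambda>t. edges (\<G> t)" 0 i]
      lift_Suc_antimono_le[of "\<lambda>t. verts (\<G> t)" 0 i] anti by auto
  have "\<G> (i + r - 1) = \<G> i"
    using const[rule_format, of "i + r - 1"] r by simp
  moreover have "?K \<subseteq> - edges (\<G> (i + r - 1))"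
    by (rule knows_sound) (use anti in \<open>auto simp: sees_def known_absent_def nbrs_iff\<close>)
  ultimately have sound: "edges (\<G> i) \<subseteq> edges (\<G> 0) - ?K"
    using init by auto
  have complete: "edges S \<subseteq> edges (\<G> i)"
    if S: "simple_graph S" "edges S \<subseteq> edges (\<G> 0) - ?K" "graph_iso S H" "v \<in> verts S" for S
  proof (cases i)
    case 0
    with S show ?thesis
      by auto
  next
    case (Suc t)
    have window: "\<G> s = \<G> i" if "t < s" "s \<le> t + r" for s
      using const[rule_format, of s] that Suc by simp
    \<comment> \<open>If \<open>{a, b}\<close> were missing, \<open>a\<close> would observe this
      during the window, and a network path of at most \<open>node_edge_diam H - 1\<close> hops
      would bring it to \<open>v\<close> in time, contradicting that \<open>S\<close> avoids
      \<open>?K\<close>.\<close>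
    have real: "{a, b} \<in> edges (\<G> i)"
      if "(v, a) \<in> adj (\<G> i) ^^ k" "k \<le> node_edge_diam H - 1" "{a, b} \<in> edges S" for a b k
    proof (rule ccontr)
      assume nonedge: "{a, b} \<notin> edges (\<G> i)"
      have "{a, b} \<in> edges (\<G> 0)"
        using that S by auto
      then have "{a, b} \<in> set (pair_facts n)"
        using edge_in_pair_facts[OF graphs] by blast
      moreover have "k * T \<le> r"
        using that T by (meson le_trans mult_le_mono1)
      ultimately have "{a, b} \<in> knows (t + r) v"
        using nonedge relpow_adj_sym[OF that(1)] relpow_adj_verts[OF graphs(1) v that(1)]
        by (intro knows_path[OF window r, where a = a and k = k])
          (auto simp: known_absent_def nbrs_iff)
      with that S Suc show False
        by auto
    qed
    \<comment> \<open>A copy that uses missing edges is detected at the missing edge closest to \<open>v\<close>: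
      up to there the paths of \<open>S\<close> exist in the network and transport the news to \<open>v\<close>.\<close>
    have path: "(v, a) \<in> adj (\<G> i) ^^ k"
      if "(v, a) \<in> adj S ^^ k" "k \<le> node_edge_diam H - 1" for a k
      using that
    proof (induction k arbitrary: a)
      case (Suc k)
      then obtain w where w: "(v, w) \<in> adj S ^^ k" "{w, a} \<in> edges S"
        by (auto simp: adj_iff)
      with Suc have "(v, w) \<in> adj (\<G> i) ^^ k"
        by simp
      moreover from this have "(w, a) \<in> adj (\<G> i)"
        unfolding adj_iff using Suc.prems(2) w(2) by (intro real[of w k]) auto
      ultimately show ?case
        by auto
    qed simp
    show ?thesis
    proof
      fix e assume e: "e \<in> edges S"
      obtain a k where a: "a \<in> e" "k \<le> node_edge_diam H - 1" "(v, a) \<in> adj S ^^ k"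
        using copy_edge_end_within_diam[OF S(1) H(1,2) S(3,4) e] .
      obtain b where b: "e = {a, b}"
        using simple_graph_edgeE[OF S(1) e] a by (metis doubleton_eq_iff insertE singletonD)
      show "e \<in> edges (\<G> i)"
        using real[OF path[OF a(3,2)] a(2)] e b by simp
    qed
  qed
  have "copies_in H (edges (\<G> i)) v = copies_in H (edges (\<G> 0) - ?K) v"
    using sound complete by (intro copies_in_cong)
  moreover have "initial_knowledge \<G> v = Some (\<G> 0)"
    using v init by (auto simp: initial_knowledge_def)
  ultimately show "output_at alg \<G> (i + r - 1) v = MemList H (\<G> i) v"
    using H graphs by (simp add: output_at_alg report_absent_def MemList_eq_copies_in)
qed

section \<open>The bandwidth bound\<close>

lemma pieces_cover:
  assumes "0 < R" "R \<le> r"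
  shows "n\<^sup>2 \<le> (r div R) * nat \<lceil>real (2 * R) * real n ^ 2 / real r\<rceil>"
proof -
  let ?T = "r div R"
  have "?T > 0"
    using assms by (simp add: div_greater_zero_iff)
  have "r < (?T + 1) * R"
    using assms dividend_less_div_times[of R r] by simp
  \<comment> \<open>Rounding \<open>r div R\<close> down loses at most a factor of two, because the
    quotient is at least one. This is the source of the constant \<open>2 * R\<close>.\<close>
  also have "\<dots> \<le> ?T * (2 * R)"
    using \<open>?T > 0\<close> by (simp add: algebra_simps)
  finally have "real r * real n ^ 2 \<le> real (?T * (2 * R)) * real n ^ 2"
    by (intro mult_right_mono) (simp_all only: of_nat_le_iff less_imp_le zero_le_power of_nat_0_le_iff)
  then have "real n ^ 2 \<le> real (?T * (2 * R)) * real n ^ 2 / real r"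
    using assms by (simp add: pos_le_divide_eq mult.commute)
  also have "\<dots> = real ?T * (real (2 * R) * real n ^ 2 / real r)"
    by simp
  also have "\<dots> \<le> real ?T * real (nat \<lceil>real (2 * R) * real n ^ 2 / real r\<rceil>)"
    by (intro mult_left_mono real_nat_ceiling_ge) auto
  finally have "real (n\<^sup>2) \<le> real (?T * nat \<lceil>real (2 * R) * real n ^ 2 / real r\<rceil>)"
    by simp
  then show ?thesis
    by (simp only: of_nat_le_iff)
qed

theorem theorem5p2:
  fixes H :: "'a ugraph"
  assumes "simple_graph H"
    and "connected_graph H"
    and "card (verts H) \<ge> 3"
  shows "\<exists>C::real. C > 0 \<and>
    (\<forall>c n r. r \<ge> node_edge_diam H - 1 \<longrightarrow>
       bandwidth_complexity (MemList H) c n r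
         \<le> enat (nat \<lceil>C * real n ^ 2 / real r\<rceil>))"
proof -
  define R where "R = node_edge_diam H - 1"
  have R: "R > 0"
    using node_edge_diam_ge_2[OF assms] by (simp add: R_def)
  have "bandwidth_complexity (MemList H) c n r
      \<le> enat (nat \<lceil>real (2 * R) * real n ^ 2 / real r\<rceil>)" if "r \<ge> R" for c n r
  proof -
    define B where "B = nat \<lceil>real (2 * R) * real n ^ 2 / real r\<rceil>"
    define T where "T = r div R"
    have T: "T > 0" "n\<^sup>2 \<le> T * B" "(node_edge_diam H - 1) * T \<le> r" and r: "r > 0"
      using that R pieces_cover[of R r n] unfolding T_def B_def R_def[symmetric]
      by (simp_all add: div_greater_zero_iff)
    have H: "simple_graph H" "connected_graph H" "card (verts H) \<ge> 2"
      using assms by auto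
    have "\<exists>A. uses_bandwidth A B \<and> solves A (MemList H) c n r"
    proof (cases "c = Node_Insertion \<or> c = Edge_Insertion")
      case True
      show ?thesis
        \<comment> \<open>Unification with the correctness lemma supplies the witness: the gossip
          algorithm for present edges here, and the one for absent edges in the other case.\<close>
        by (rule exI, rule conjI[OF gossip.uses_bandwidth_alg insertion_solves[OF H True T r]])
    next
      case False
      then have "c = Node_Deletion \<or> c = Edge_Deletion"
        by (cases c) auto
      show ?thesis
        by (rule exI, rule conjI[OF gossip.uses_bandwidth_alg deletion_solves[OF H \<open>c = _ \<or> _\<close> T r]])
    qed
    then have "bandwidth_complexity (MemList H) c n r \<le> enat B"
      unfolding bandwidth_complexity_def by (intro Inf_lower) auto
    then show ?thesis
      by (simp add: B_def)
  qed
  with R show ?thesis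
    unfolding R_def[symmetric] by (intro exI[of _ "real (2 * R)"]) auto
qed

end
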